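(* The category of specialization posets is equivalent to the category whose objects are the surjective order preserving maps between posets and whose morphisms are the commuting squares of order preserving maps.
   Context: A specialization poset is a triple $(P,\leq,\sqsubseteq)$ where $(P,\leq)$ is a partially ordered set and $\sqsubseteq$ is a preorder (reflexive and transitive relation) on $P$ coarser than $\leq$ (that is, $a\leq b$ implies $a\sqsubseteq b$). Morphisms of specialization posets are functions $\varphi$ such that $a\leq b$ implies $\varphi(a)\leq\varphi(b)$ and $a\sqsubseteq b$ implies $\varphi(a)\sqsubseteq\varphi(b)$. The second category is the full subcategory of the arrow category of the category of posets and order preserving maps whose objects are the surjective order preserving maps; the additional maps in the commuting squares are not required to be surjective. *)

theory Defs
  imports Main "HOL-Library.FuncSet"
begin

section \<open>Categories, functors, equivalence\<close>

record ('o, 'm) category =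
  Obj :: "'o set"
  Arr :: "'m set"
  Dom :: "'m \<Rightarrow> 'o"
  Cod :: "'m \<Rightarrow> 'o"
  Id :: "'o \<Rightarrow> 'm"
  Comp :: "'m \<Rightarrow> 'm \<Rightarrow> 'm"  (infixl "\<cdot>\<index>" 70)

definition Hom :: "('o, 'm) category \<Rightarrow> 'o \<Rightarrow> 'o \<Rightarrow> 'm set" where
  "Hom C X Y = {f \<in> Arr C. Dom C f = X \<and> Cod C f = Y}"

locale category =
  fixes C :: "('o, 'm) category" (structure)
  assumes Dom_in_Obj: "f \<in> Arr C \<Longrightarrow> Dom C f \<in> Obj C"
    and Cod_in_Obj: "f \<in> Arr C \<Longrightarrow> Cod C f \<in> Obj C"
    and Id_in_Hom: "X \<in> Obj C \<Longrightarrow> Id C X \<in> Hom C X X"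
    and Comp_in_Hom: "f \<in> Hom C X Y \<Longrightarrow> g \<in> Hom C Y Z \<Longrightarrow> g \<cdot> f \<in> Hom C X Z"
    and Comp_Id: "f \<in> Hom C X Y \<Longrightarrow> f \<cdot> Id C X = f"
    and Id_Comp: "f \<in> Hom C X Y \<Longrightarrow> Id C Y \<cdot> f = f"
    and Comp_assoc: "f \<in> Hom C W X \<Longrightarrow> g \<in> Hom C X Y \<Longrightarrow> h \<in> Hom C Y Z
      \<Longrightarrow> (h \<cdot> g) \<cdot> f = h \<cdot> (g \<cdot> f)"

definition isomorphism :: "('o, 'm) category \<Rightarrow> 'm \<Rightarrow> bool" where
  "isomorphism C f \<longleftrightarrow> f \<in> Arr C \<and>
    (\<exists>g \<in> Hom C (Cod C f) (Dom C f).
      g \<cdot>\<^bsub>C\<^esub> f = Id C (Dom C f) \<and> f \<cdot>\<^bsub>C\<^esub> g = Id C (Cod C f))"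

record ('o1, 'm1, 'o2, 'm2) cat_map =
  on_Obj :: "'o1 \<Rightarrow> 'o2"
  on_Arr :: "'m1 \<Rightarrow> 'm2"

definition is_functor ::
    "('o1, 'm1) category \<Rightarrow> ('o2, 'm2) category \<Rightarrow> ('o1, 'm1, 'o2, 'm2) cat_map \<Rightarrow> bool" where
  "is_functor C D F \<longleftrightarrow> category C \<and> category D \<and>
    (\<forall>X \<in> Obj C. on_Obj F X \<in> Obj D) \<and>
    (\<forall>f \<in> Arr C. on_Arr F f \<in> Hom D (on_Obj F (Dom C f)) (on_Obj F (Cod C f))) \<and>
    (\<forall>X \<in> Obj C. on_Arr F (Id C X) = Id D (on_Obj F X)) \<and>
    (\<forall>f \<in> Arr C. \<forall>g \<in> Arr C. Cod C f = Dom C g \<longrightarrow>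
      on_Arr F (g \<cdot>\<^bsub>C\<^esub> f) = on_Arr F g \<cdot>\<^bsub>D\<^esub> on_Arr F f)"

definition id_functor :: "('o, 'm, 'o, 'm) cat_map" where
  "id_functor = \<lparr>on_Obj = id, on_Arr = id\<rparr>"

definition comp_functor ::
    "('o2, 'm2, 'o3, 'm3) cat_map \<Rightarrow> ('o1, 'm1, 'o2, 'm2) cat_map
      \<Rightarrow> ('o1, 'm1, 'o3, 'm3) cat_map" where
  "comp_functor G F = \<lparr>on_Obj = on_Obj G \<circ> on_Obj F, on_Arr = on_Arr G \<circ> on_Arr F\<rparr>"

definition natural_isomorphism ::
    "('o1, 'm1) category \<Rightarrow> ('o2, 'm2) category \<Rightarrow> ('o1, 'm1, 'o2, 'm2) cat_map
      \<Rightarrow> ('o1, 'm1, 'o2, 'm2) cat_map \<Rightarrow> ('o1 \<Rightarrow> 'm2) \<Rightarrow> bool" where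
  "natural_isomorphism C D F G \<tau> \<longleftrightarrow> is_functor C D F \<and> is_functor C D G \<and>
    (\<forall>X \<in> Obj C. \<tau> X \<in> Hom D (on_Obj F X) (on_Obj G X) \<and> isomorphism D (\<tau> X)) \<and>
    (\<forall>f \<in> Arr C. on_Arr G f \<cdot>\<^bsub>D\<^esub> \<tau> (Dom C f) = \<tau> (Cod C f) \<cdot>\<^bsub>D\<^esub> on_Arr F f)"

definition equivalent_categories ::
    "('o1, 'm1) category \<Rightarrow> ('o2, 'm2) category \<Rightarrow> bool" where
  "equivalent_categories C D \<longleftrightarrow> category C \<and> category D \<and>
    (\<exists>F G \<eta> \<epsilon>. is_functor C D F \<and> is_functor D C G \<and>
      natural_isomorphism C C id_functor (comp_functor G F) \<eta> \<and>
      natural_isomorphism D D (comp_functor F G) id_functor \<epsilon>)"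


section \<open>Constructions of categories\<close>

datatype ('o, 'm) arrow = Arrow (source: 'o) (target: 'o) (underlying: 'm)

text \<open>
  Objects are structured sets with underlying set \<open>U X\<close>, and \<open>H X Y f\<close> says that \<open>f\<close>
  preserves the structure. Functions are taken to be extensional (\<open>undefined\<close> outside
  \<open>U X\<close>), so that equality of morphisms is equality of functions on \<open>U X\<close>.
\<close>
definition concrete_category ::
    "'o set \<Rightarrow> ('o \<Rightarrow> 'a set) \<Rightarrow> ('o \<Rightarrow> 'o \<Rightarrow> ('a \<Rightarrow> 'a) \<Rightarrow> bool)
      \<Rightarrow> ('o, ('o, 'a \<Rightarrow> 'a) arrow) category" where
  "concrete_category S U H =
    \<lparr>Obj = S,
     Arr = {Arrow X Y f | X Y f. X \<in> S \<and> Y \<in> S \<and> f \<in> U X \<rightarrow>\<^sub>E U Y \<and> H X Y f},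
     Dom = source,
     Cod = target,
     Id = (\<lambda>X. Arrow X X (\<lambda>x\<in>U X. x)),
     Comp = (\<lambda>g f. Arrow (source f) (target g)
                     (compose (U (source f)) (underlying g) (underlying f)))\<rparr>"

definition full_subcategory :: "('o, 'm) category \<Rightarrow> 'o set \<Rightarrow> ('o, 'm) category" where
  "full_subcategory C S = C
    \<lparr>Obj := Obj C \<inter> S,
     Arr := {f \<in> Arr C. Dom C f \<in> S \<and> Cod C f \<in> S}\<rparr>"

text \<open>
  A morphism \<open>Arrow p q (u, v)\<close> from \<open>p\<close> to \<open>q\<close> is the commuting square with vertical
  sides \<open>p\<close>, \<open>q\<close>, top \<open>u\<close> and bottom \<open>v\<close>.
\<close>
definition arrow_category ::
    "('o, 'm) category \<Rightarrow> ('m, ('m, 'm \<times> 'm) arrow) category" where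
  "arrow_category C =
    \<lparr>Obj = Arr C,
     Arr = {Arrow p q (u, v) | p q u v. p \<in> Arr C \<and> q \<in> Arr C \<and>
              u \<in> Hom C (Dom C p) (Dom C q) \<and> v \<in> Hom C (Cod C p) (Cod C q) \<and>
              q \<cdot>\<^bsub>C\<^esub> u = v \<cdot>\<^bsub>C\<^esub> p},
     Dom = source,
     Cod = target,
     Id = (\<lambda>p. Arrow p p (Id C (Dom C p), Id C (Cod C p))),
     Comp = (\<lambda>g f. Arrow (source f) (target g)
                     (fst (underlying g) \<cdot>\<^bsub>C\<^esub> fst (underlying f),
                      snd (underlying g) \<cdot>\<^bsub>C\<^esub> snd (underlying f)))\<rparr>"


section \<open>Posets and specialization posets\<close>

text \<open>
  The underlying sets are arbitrary (possibly empty) subsets of a type \<open>'a\<close>, which plays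
  the role of the universe. The relations \<open>le\<close> and \<open>spec\<close> are subsets of
  \<open>points P \<times> points P\<close>, since this is part of \<^const>\<open>preorder_on\<close>.
\<close>

record 'a poset =
  points :: "'a set"
  le :: "'a rel"

record 'a spec_poset = "'a poset" +
  spec :: "'a rel"

definition is_poset :: "('a, 'b) poset_scheme \<Rightarrow> bool" where
  "is_poset P \<longleftrightarrow> partial_order_on (points P) (le P)"

definition is_spec_poset :: "'a spec_poset \<Rightarrow> bool" where
  "is_spec_poset P \<longleftrightarrow> is_poset P \<and> preorder_on (points P) (spec P) \<and> le P \<subseteq> spec P"

definition preserves :: "'a rel \<Rightarrow> 'a rel \<Rightarrow> ('a \<Rightarrow> 'a) \<Rightarrow> bool" where
  "preserves r s f \<longleftrightarrow> (\<forall>(a, b) \<in> r. (f a, f b) \<in> s)"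

definition Poset :: "('a poset, ('a poset, 'a \<Rightarrow> 'a) arrow) category" where
  "Poset = concrete_category {P. is_poset P} points (\<lambda>P Q f. preserves (le P) (le Q) f)"

definition SpecPoset :: "('a spec_poset, ('a spec_poset, 'a \<Rightarrow> 'a) arrow) category" where
  "SpecPoset = concrete_category {P. is_spec_poset P} points
     (\<lambda>P Q f. preserves (le P) (le Q) f \<and> preserves (spec P) (spec Q) f)"

type_synonym 'a poset_map = "('a poset, 'a \<Rightarrow> 'a) arrow"

definition SurjPoset ::
    "('a poset_map, ('a poset_map, 'a poset_map \<times> 'a poset_map) arrow) category" where
  "SurjPoset = full_subcategory (arrow_category Poset)
     {p. underlying p ` points (source p) = points (target p)}"

end

theory Submission
  imports Defs
begin

text \<open>
  A surjective monotone map \<open>p : P \<rightarrow> Q\<close> turns its source into a specialization poset: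
  put \<open>a \<sqsubseteq> b\<close> when \<open>p a \<le> p b\<close>. The top side \<open>u\<close> of a commuting square from \<open>p\<close> to
  \<open>p'\<close> preserves these preorders, so forgetting the bottom side is a functor. This functor
  is an equivalence. It is faithful because \<open>p\<close> is surjective, hence epic, so \<open>u\<close>
  determines the bottom side. It is full because a map that preserves the pulled back
  preorders descends to the targets, which are, up to isomorphism, the poset reflections of
  these preorders (\<open>pullback_functor_fully_faithful\<close>). It is surjective on objects because
  every preorder is pulled back from its poset reflection along the quotient map
  (\<open>pullback_spec_surj\<close>).

  A fully faithful functor that is surjective on objects has a strict section, obtained by
  choosing preimages of objects and lifting arrows uniquely
  (\<open>equivalent_categories_if_fully_faithful_and_surjective\<close>).
\<close>


section \<open>Functors and equivalences\<close>

lemma isomorphismI: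
  assumes "f \<in> Hom C X Y" "g \<in> Hom C Y X" "g \<cdot>\<^bsub>C\<^esub> f = Id C X" "f \<cdot>\<^bsub>C\<^esub> g = Id C Y"
  shows "isomorphism C f"
  using assms unfolding isomorphism_def Hom_def by auto

lemma is_functor_HomD:
  assumes "is_functor C D F" "f \<in> Hom C X Y"
  shows "on_Arr F f \<in> Hom D (on_Obj F X) (on_Obj F Y)"
  using assms unfolding is_functor_def Hom_def by auto

lemma is_functor_CompD:
  assumes "is_functor C D F" "f \<in> Hom C X Y" "g \<in> Hom C Y Z"
  shows "on_Arr F (g \<cdot>\<^bsub>C\<^esub> f) = on_Arr F g \<cdot>\<^bsub>D\<^esub> on_Arr F f"
  using assms unfolding is_functor_def Hom_def by auto

lemma is_functorI:
  assumes "category C" "category D"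
    and "\<And>X. X \<in> Obj C \<Longrightarrow> on_Obj F X \<in> Obj D"
    and "\<And>X Y f. f \<in> Hom C X Y \<Longrightarrow> on_Arr F f \<in> Hom D (on_Obj F X) (on_Obj F Y)"
    and "\<And>X. X \<in> Obj C \<Longrightarrow> on_Arr F (Id C X) = Id D (on_Obj F X)"
    and "\<And>X Y Z f g. f \<in> Hom C X Y \<Longrightarrow> g \<in> Hom C Y Z \<Longrightarrow>
      on_Arr F (g \<cdot>\<^bsub>C\<^esub> f) = on_Arr F g \<cdot>\<^bsub>D\<^esub> on_Arr F f"
  shows "is_functor C D F"
  using assms unfolding is_functor_def Hom_def by auto

lemma is_functor_id: "category C \<Longrightarrow> is_functor C C id_functor"
  by (rule is_functorI) (auto simp: id_functor_def)

lemma is_functor_comp: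
  assumes F: "is_functor C D F" and G: "is_functor D E G"
  shows "is_functor C E (comp_functor G F)"
proof (rule is_functorI)
  show "category C" "category E"
    using F G unfolding is_functor_def by blast+
next
  fix X assume "X \<in> Obj C"
  then show "on_Obj (comp_functor G F) X \<in> Obj E"
    and "on_Arr (comp_functor G F) (Id C X) = Id E (on_Obj (comp_functor G F) X)"
    using F G unfolding is_functor_def comp_functor_def by auto
next
  fix X Y f assume "f \<in> Hom C X Y"
  then show "on_Arr (comp_functor G F) f
      \<in> Hom E (on_Obj (comp_functor G F) X) (on_Obj (comp_functor G F) Y)"
    using is_functor_HomD[OF F] is_functor_HomD[OF G] by (simp add: comp_functor_def)
next
  fix X Y Z f g assume f: "f \<in> Hom C X Y" and g: "g \<in> Hom C Y Z"
  show "on_Arr (comp_functor G F) (g \<cdot>\<^bsub>C\<^esub> f)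
      = on_Arr (comp_functor G F) g \<cdot>\<^bsub>E\<^esub> on_Arr (comp_functor G F) f"
    by (simp add: comp_functor_def is_functor_CompD[OF F f g]
        is_functor_CompD[OF G is_functor_HomD[OF F f] is_functor_HomD[OF F g]])
qed

text \<open>
  A right inverse \<open>s\<close> of \<open>G\<close> on objects extends to a functor because every arrow
  \<open>f : X \<rightarrow> Y\<close> has exactly one lift \<open>s X \<rightarrow> s Y\<close>. This functor is a strict section of \<open>G\<close>,
  and \<open>s (G p)\<close> is isomorphic to \<open>p\<close> through the lift of the identity of \<open>G p\<close>. Any
  identity between lifts may be checked after applying \<open>G\<close>.
\<close>
lemma equivalent_categories_if_fully_faithful_and_surjective:
  assumes G: "is_functor D C G"
    and surj: "\<And>X. X \<in> Obj C \<Longrightarrow> \<exists>p \<in> Obj D. on_Obj G p = X"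
    and ff: "\<And>p q. p \<in> Obj D \<Longrightarrow> q \<in> Obj D \<Longrightarrow>
      bij_betw (on_Arr G) (Hom D p q) (Hom C (on_Obj G p) (on_Obj G q))"
  shows "equivalent_categories C D"
proof -
  interpret C: category C using G unfolding is_functor_def by blast
  interpret D: category D using G unfolding is_functor_def by blast
  let ?G = "on_Obj G" and ?g = "on_Arr G"
  have G_Obj: "?G p \<in> Obj C" if "p \<in> Obj D" for p
    using G that unfolding is_functor_def by blast
  have G_Id: "?g (Id D p) = Id C (?G p)" if "p \<in> Obj D" for p
    using G that unfolding is_functor_def by blast
  note G_Hom = is_functor_HomD[OF G] and G_Comp = is_functor_CompD[OF G]
  have Hom_Obj: "X \<in> Obj C" "Y \<in> Obj C" if "f \<in> Hom C X Y" for f X Y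
    using that C.Dom_in_Obj C.Cod_in_Obj unfolding Hom_def by auto
  have Hom_Obj_D: "p \<in> Obj D" "q \<in> Obj D" if "f \<in> Hom D p q" for f p q
    using that D.Dom_in_Obj D.Cod_in_Obj unfolding Hom_def by auto
  have faithful: "h = k" if "h \<in> Hom D p q" "k \<in> Hom D p q" "?g h = ?g k" for p q h k
    using ff[OF Hom_Obj_D[OF that(1)]] that unfolding bij_betw_def by (auto dest: inj_onD)
  define s where "s X = (SOME p. p \<in> Obj D \<and> ?G p = X)" for X
  have "s X \<in> Obj D \<and> ?G (s X) = X" if "X \<in> Obj C" for X
    unfolding s_def by (rule someI_ex) (use surj[OF that] in blast)
  then have s: "s X \<in> Obj D" "?G (s X) = X" if "X \<in> Obj C" for X
    using that by auto
  define lift where "lift p q = inv_into (Hom D p q) ?g" for p q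
  have lift: "lift p q f \<in> Hom D p q" "?g (lift p q f) = f"
    if "p \<in> Obj D" "q \<in> Obj D" "f \<in> Hom C (?G p) (?G q)" for p q f
    using bij_betw_apply[OF bij_betw_inv_into[OF ff[OF that(1,2)]] that(3)]
      bij_betw_inv_into_right[OF ff[OF that(1,2)] that(3)]
    unfolding lift_def by simp_all
  define F where
    "F = \<lparr>on_Obj = s, on_Arr = (\<lambda>f. lift (s (Dom C f)) (s (Cod C f)) f)\<rparr>"
  have F_Obj[simp]: "on_Obj F = s"
    by (simp add: F_def)
  have F_Hom: "on_Arr F f \<in> Hom D (s X) (s Y)" and GF_Hom: "?g (on_Arr F f) = f"
    if "f \<in> Hom C X Y" for X Y f
  proof -
    have "X = Dom C f" "Y = Cod C f" using that by (auto simp: Hom_def)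
    then have "on_Arr F f = lift (s X) (s Y) f" by (simp add: F_def)
    then show "on_Arr F f \<in> Hom D (s X) (s Y)" "?g (on_Arr F f) = f"
      using lift[of "s X" "s Y" f] that s[OF Hom_Obj(1)[OF that]] s[OF Hom_Obj(2)[OF that]]
      by simp_all
  qed
  have F: "is_functor C D F"
  proof (rule is_functorI)
    show "category C" "category D" by unfold_locales
    show "on_Obj F X \<in> Obj D" if "X \<in> Obj C" for X
      using s that by simp
    show "on_Arr F f \<in> Hom D (on_Obj F X) (on_Obj F Y)" if "f \<in> Hom C X Y" for X Y f
      using F_Hom[OF that] by simp
    show "on_Arr F (Id C X) = Id D (on_Obj F X)" if "X \<in> Obj C" for X
    proof -
      note Id = C.Id_in_Hom[OF that]
      have "on_Arr F (Id C X) = Id D (s X)"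
        by (rule faithful[OF F_Hom[OF Id] D.Id_in_Hom[OF s(1)[OF that]]])
          (simp add: GF_Hom[OF Id] G_Id s that)
      then show ?thesis by simp
    qed
    show "on_Arr F (g \<cdot>\<^bsub>C\<^esub> f) = on_Arr F g \<cdot>\<^bsub>D\<^esub> on_Arr F f"
      if f: "f \<in> Hom C X Y" and g: "g \<in> Hom C Y Z" for X Y Z f g
    proof (rule faithful)
      show "on_Arr F (g \<cdot>\<^bsub>C\<^esub> f) \<in> Hom D (s X) (s Z)"
        by (rule F_Hom[OF C.Comp_in_Hom[OF f g]])
      show "on_Arr F g \<cdot>\<^bsub>D\<^esub> on_Arr F f \<in> Hom D (s X) (s Z)"
        by (rule D.Comp_in_Hom[OF F_Hom[OF f] F_Hom[OF g]])
      show "?g (on_Arr F (g \<cdot>\<^bsub>C\<^esub> f)) = ?g (on_Arr F g \<cdot>\<^bsub>D\<^esub> on_Arr F f)"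
        using G_Comp[OF F_Hom[OF f] F_Hom[OF g]] GF_Hom[OF C.Comp_in_Hom[OF f g]]
          GF_Hom[OF f] GF_Hom[OF g] by simp
    qed
  qed
  have "natural_isomorphism C C id_functor (comp_functor G F) (Id C)"
    unfolding natural_isomorphism_def
  proof (intro conjI ballI)
    show "is_functor C C id_functor" "is_functor C C (comp_functor G F)"
      using is_functor_id is_functor_comp[OF F G] C.category_axioms by auto
    show "Id C X \<in> Hom C (on_Obj id_functor X) (on_Obj (comp_functor G F) X)"
      if "X \<in> Obj C" for X
      using that s C.Id_in_Hom by (simp add: id_functor_def comp_functor_def)
    show "isomorphism C (Id C X)" if "X \<in> Obj C" for X
      using C.Id_in_Hom[OF that] C.Comp_Id[OF C.Id_in_Hom[OF that]]
      by (intro isomorphismI)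
    show "on_Arr (comp_functor G F) f \<cdot>\<^bsub>C\<^esub> Id C (Dom C f)
        = Id C (Cod C f) \<cdot>\<^bsub>C\<^esub> on_Arr id_functor f" if "f \<in> Arr C" for f
    proof -
      have "f \<in> Hom C (Dom C f) (Cod C f)" using that by (simp add: Hom_def)
      then show ?thesis
        using GF_Hom C.Comp_Id C.Id_Comp by (simp add: id_functor_def comp_functor_def)
    qed
  qed
  moreover have "natural_isomorphism D D (comp_functor F G) id_functor
      (\<lambda>p. lift (s (?G p)) p (Id C (?G p)))" (is "natural_isomorphism _ _ _ _ ?\<epsilon>")
  proof -
    have \<epsilon>: "?\<epsilon> p \<in> Hom D (s (?G p)) p" "?g (?\<epsilon> p) = Id C (?G p)" if "p \<in> Obj D" for p
      using lift[of "s (?G p)" p "Id C (?G p)"] that s[OF G_Obj[OF that]]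
        C.Id_in_Hom[OF G_Obj[OF that]] by simp_all
    have iso: "isomorphism D (?\<epsilon> p)" if p: "p \<in> Obj D" for p
    proof -
      let ?\<delta> = "lift p (s (?G p)) (Id C (?G p))" and ?sp = "s (?G p)"
      have sp: "?sp \<in> Obj D" "?G ?sp = ?G p" using s G_Obj[OF p] by auto
      have I: "Id C (?G p) \<in> Hom C (?G p) (?G p)" using C.Id_in_Hom G_Obj[OF p] by auto
      have \<delta>: "?\<delta> \<in> Hom D p ?sp" "?g ?\<delta> = Id C (?G p)"
        using lift[of p ?sp "Id C (?G p)"] p sp I by auto
      have "?\<delta> \<cdot>\<^bsub>D\<^esub> ?\<epsilon> p = Id D ?sp"
        by (rule faithful[OF D.Comp_in_Hom[OF \<epsilon>(1)[OF p] \<delta>(1)] D.Id_in_Hom[OF sp(1)]])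
          (simp add: G_Comp[OF \<epsilon>(1)[OF p] \<delta>(1)] \<epsilon>(2)[OF p] \<delta>(2) G_Id sp C.Comp_Id[OF I])
      moreover have "?\<epsilon> p \<cdot>\<^bsub>D\<^esub> ?\<delta> = Id D p"
        by (rule faithful[OF D.Comp_in_Hom[OF \<delta>(1) \<epsilon>(1)[OF p]] D.Id_in_Hom[OF p]])
          (simp add: G_Comp[OF \<delta>(1) \<epsilon>(1)[OF p]] \<epsilon>(2)[OF p] \<delta>(2) G_Id p C.Comp_Id[OF I])
      ultimately show ?thesis
        by (rule isomorphismI[OF \<epsilon>(1)[OF p] \<delta>(1)])
    qed
    have nat: "f \<cdot>\<^bsub>D\<^esub> ?\<epsilon> p = ?\<epsilon> q \<cdot>\<^bsub>D\<^esub> on_Arr F (?g f)" if f: "f \<in> Hom D p q" for f p q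
    proof (rule faithful)
      note pq = Hom_Obj_D[OF f]
      note Gf = G_Hom[OF f]
      show "f \<cdot>\<^bsub>D\<^esub> ?\<epsilon> p \<in> Hom D (s (?G p)) q"
        by (rule D.Comp_in_Hom[OF \<epsilon>(1)[OF pq(1)] f])
      show "?\<epsilon> q \<cdot>\<^bsub>D\<^esub> on_Arr F (?g f) \<in> Hom D (s (?G p)) q"
        by (rule D.Comp_in_Hom[OF F_Hom[OF Gf] \<epsilon>(1)[OF pq(2)]])
      show "?g (f \<cdot>\<^bsub>D\<^esub> ?\<epsilon> p) = ?g (?\<epsilon> q \<cdot>\<^bsub>D\<^esub> on_Arr F (?g f))"
        by (simp add: G_Comp[OF \<epsilon>(1)[OF pq(1)] f] G_Comp[OF F_Hom[OF Gf] \<epsilon>(1)[OF pq(2)]]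
            \<epsilon>(2) pq GF_Hom[OF Gf] C.Comp_Id[OF Gf] C.Id_Comp[OF Gf])
    qed
    show ?thesis
      unfolding natural_isomorphism_def
      using is_functor_id[OF D.category_axioms] is_functor_comp[OF G F] \<epsilon>(1) iso nat
      by (auto simp: id_functor_def comp_functor_def Hom_def)
  qed
  ultimately show ?thesis
    unfolding equivalent_categories_def
    using C.category_axioms D.category_axioms F G by blast
qed


section \<open>The categories of specialization posets and of surjections\<close>

lemma Hom_concrete_category:
  "Hom (concrete_category S U H) X Y =
    {Arrow X Y f | f. X \<in> S \<and> Y \<in> S \<and> f \<in> U X \<rightarrow>\<^sub>E U Y \<and> H X Y f}"
  by (auto simp: Hom_def concrete_category_def)

lemma category_concrete_category:
  assumes Id: "\<And>X. X \<in> S \<Longrightarrow> H X X (\<lambda>x\<in>U X. x)"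
    and Comp: "\<And>X Y Z f g. X \<in> S \<Longrightarrow> Y \<in> S \<Longrightarrow> Z \<in> S \<Longrightarrow>
      f \<in> U X \<rightarrow>\<^sub>E U Y \<Longrightarrow> g \<in> U Y \<rightarrow>\<^sub>E U Z \<Longrightarrow> H X Y f \<Longrightarrow> H Y Z g \<Longrightarrow>
      H X Z (compose (U X) g f)"
  shows "category (concrete_category S U H)" (is "category ?C")
proof
  fix f assume "f \<in> Arr ?C"
  then show "Dom ?C f \<in> Obj ?C" "Cod ?C f \<in> Obj ?C"
    by (auto simp: concrete_category_def)
next
  fix X assume "X \<in> Obj ?C"
  then show "Id ?C X \<in> Hom ?C X X"
    using Id by (auto simp: Hom_concrete_category) (auto simp: concrete_category_def)
next
  fix f g X Y Z assume "f \<in> Hom ?C X Y" "g \<in> Hom ?C Y Z"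
  then show "g \<cdot>\<^bsub>?C\<^esub> f \<in> Hom ?C X Z"
    using Comp[of X Y Z]
    by (auto simp: Hom_concrete_category)
      (auto simp: concrete_category_def compose_def PiE_iff)
next
  fix f X Y assume "f \<in> Hom ?C X Y"
  then show "f \<cdot>\<^bsub>?C\<^esub> Id ?C X = f" "Id ?C Y \<cdot>\<^bsub>?C\<^esub> f = f"
    by (auto simp: Hom_concrete_category)
      (auto simp: concrete_category_def PiE_iff Pi_iff compose_def extensional_def fun_eq_iff)
next
  fix f g h W X Y Z
  assume "f \<in> Hom ?C W X" "g \<in> Hom ?C X Y" "h \<in> Hom ?C Y Z"
  then show "(h \<cdot>\<^bsub>?C\<^esub> g) \<cdot>\<^bsub>?C\<^esub> f = h \<cdot>\<^bsub>?C\<^esub> (g \<cdot>\<^bsub>?C\<^esub> f)"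
    by (auto simp: Hom_concrete_category)
      (auto simp: concrete_category_def PiE_iff Pi_iff compose_def fun_eq_iff)
qed

lemma Hom_arrow_category:
  "Hom (arrow_category C) p q = {Arrow p q (u, v) | u v. p \<in> Arr C \<and> q \<in> Arr C \<and>
    u \<in> Hom C (Dom C p) (Dom C q) \<and> v \<in> Hom C (Cod C p) (Cod C q) \<and>
    q \<cdot>\<^bsub>C\<^esub> u = v \<cdot>\<^bsub>C\<^esub> p}"
  by (auto simp: Hom_def arrow_category_def)

lemma category_arrow_category:
  assumes "category C"
  shows "category (arrow_category C)" (is "category ?A")
proof -
  interpret category C by fact
  note Hom_A = Hom_arrow_category[of C]
  have arr: "p \<in> Hom C (Dom C p) (Cod C p)" if "p \<in> Arr C" for p
    using that by (simp add: Hom_def)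
  show ?thesis
  proof
    fix f assume "f \<in> Arr ?A"
    then show "Dom ?A f \<in> Obj ?A" "Cod ?A f \<in> Obj ?A"
      by (auto simp: arrow_category_def)
  next
    fix p assume "p \<in> Obj ?A"
    then have "p \<in> Arr C" by (simp add: arrow_category_def)
    with Comp_Id[OF arr] Id_Comp[OF arr] show "Id ?A p \<in> Hom ?A p p"
      by (auto simp: Hom_A) (auto simp: arrow_category_def Id_in_Hom Dom_in_Obj Cod_in_Obj)
  next
    fix f g p q r assume "f \<in> Hom ?A p q" "g \<in> Hom ?A q r"
    then obtain u v u' v' where f: "f = Arrow p q (u, v)" and g: "g = Arrow q r (u', v')"
      and p: "p \<in> Arr C" and q: "q \<in> Arr C" and r: "r \<in> Arr C"
      and u: "u \<in> Hom C (Dom C p) (Dom C q)" and v: "v \<in> Hom C (Cod C p) (Cod C q)"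
      and u': "u' \<in> Hom C (Dom C q) (Dom C r)" and v': "v' \<in> Hom C (Cod C q) (Cod C r)"
      and eqs: "q \<cdot>\<^bsub>C\<^esub> u = v \<cdot>\<^bsub>C\<^esub> p" "r \<cdot>\<^bsub>C\<^esub> u' = v' \<cdot>\<^bsub>C\<^esub> q"
      unfolding Hom_A by auto
    have "r \<cdot>\<^bsub>C\<^esub> (u' \<cdot>\<^bsub>C\<^esub> u) = (v' \<cdot>\<^bsub>C\<^esub> q) \<cdot>\<^bsub>C\<^esub> u"
      using Comp_assoc[OF u u' arr[OF r]] eqs by simp
    also have "\<dots> = v' \<cdot>\<^bsub>C\<^esub> (v \<cdot>\<^bsub>C\<^esub> p)"
      using Comp_assoc[OF u arr[OF q] v'] eqs by simp
    also have "\<dots> = (v' \<cdot>\<^bsub>C\<^esub> v) \<cdot>\<^bsub>C\<^esub> p"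
      using Comp_assoc[OF arr[OF p] v v'] by simp
    finally have "Arrow p r (u' \<cdot>\<^bsub>C\<^esub> u, v' \<cdot>\<^bsub>C\<^esub> v) \<in> Hom ?A p r"
      using p r Comp_in_Hom[OF u u'] Comp_in_Hom[OF v v'] by (auto simp: Hom_A)
    then show "g \<cdot>\<^bsub>?A\<^esub> f \<in> Hom ?A p r"
      by (simp add: f g arrow_category_def)
  next
    fix f p q assume "f \<in> Hom ?A p q"
    then show "f \<cdot>\<^bsub>?A\<^esub> Id ?A p = f" "Id ?A q \<cdot>\<^bsub>?A\<^esub> f = f"
      by (auto simp: Hom_A) (auto simp: arrow_category_def Comp_Id Id_Comp)
  next
    fix f g h p q r s
    assume "f \<in> Hom ?A p q" "g \<in> Hom ?A q r" "h \<in> Hom ?A r s"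
    then show "(h \<cdot>\<^bsub>?A\<^esub> g) \<cdot>\<^bsub>?A\<^esub> f = h \<cdot>\<^bsub>?A\<^esub> (g \<cdot>\<^bsub>?A\<^esub> f)"
      by (auto simp: Hom_A) (auto simp: arrow_category_def Comp_assoc)
  qed
qed

lemma Hom_full_subcategory:
  "Hom (full_subcategory C S) X Y = (if X \<in> S \<and> Y \<in> S then Hom C X Y else {})"
  by (auto simp: Hom_def full_subcategory_def)

lemma category_full_subcategory:
  assumes "category C"
  shows "category (full_subcategory C S)"
proof -
  interpret category C by fact
  have [simp]: "Id (full_subcategory C S) = Id C" "Comp (full_subcategory C S) = Comp C"
    by (auto simp: full_subcategory_def)
  show ?thesis
    by unfold_locales
      (auto simp: Hom_full_subcategory Comp_in_Hom Comp_Id Id_Comp Comp_assoc split: if_splits,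
       auto simp: full_subcategory_def Dom_in_Obj Cod_in_Obj Id_in_Hom)
qed

lemma preserves_restrict_id: "r \<subseteq> A \<times> A \<Longrightarrow> preserves r r (\<lambda>x\<in>A. x)"
  by (auto simp: preserves_def)

lemma preserves_compose:
  "r \<subseteq> A \<times> A \<Longrightarrow> preserves r s f \<Longrightarrow> preserves s t g \<Longrightarrow> preserves r t (compose A g f)"
  by (fastforce simp: preserves_def compose_def)

lemma is_poset_le_subset: "is_poset P \<Longrightarrow> le P \<subseteq> points P \<times> points P"
  by (simp add: is_poset_def partial_order_on_def preorder_on_def)

lemma is_spec_poset_subset:
  assumes "is_spec_poset P"
  shows "le P \<subseteq> points P \<times> points P" "spec P \<subseteq> points P \<times> points P"
  using assms is_poset_le_subset[of P]
  by (auto simp: is_spec_poset_def preorder_on_def is_poset_def partial_order_on_def)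

lemma category_Poset: "category Poset"
  unfolding Poset_def
  by (rule category_concrete_category)
    (auto intro!: preserves_restrict_id preserves_compose dest: is_poset_le_subset)

lemma category_SpecPoset: "category SpecPoset"
  unfolding SpecPoset_def
  by (rule category_concrete_category)
    (auto intro!: preserves_restrict_id preserves_compose dest: is_spec_poset_subset)

lemma category_SurjPoset: "category SurjPoset"
  unfolding SurjPoset_def
  by (intro category_full_subcategory category_arrow_category category_Poset)

lemma Hom_SpecPoset:
  "Hom SpecPoset P Q = {Arrow P Q f | f. is_spec_poset P \<and> is_spec_poset Q \<and>
    f \<in> points P \<rightarrow>\<^sub>E points Q \<and> preserves (le P) (le Q) f \<and> preserves (spec P) (spec Q) f}"
  by (auto simp: SpecPoset_def Hom_concrete_category)

lemma Hom_Poset: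
  "Hom Poset P Q = {Arrow P Q f | f. is_poset P \<and> is_poset Q \<and>
    f \<in> points P \<rightarrow>\<^sub>E points Q \<and> preserves (le P) (le Q) f}"
  by (auto simp: Poset_def Hom_concrete_category)

lemma Obj_SurjPoset:
  "Obj SurjPoset = {Arrow P Q p | P Q p. is_poset P \<and> is_poset Q \<and>
    p \<in> points P \<rightarrow>\<^sub>E points Q \<and> preserves (le P) (le Q) p \<and> p ` points P = points Q}"
  by (auto simp: SurjPoset_def full_subcategory_def arrow_category_def Poset_def
      concrete_category_def)

text \<open>
  Composites in the category of posets are restricted to the source, so a square commutes as
  soon as it does so pointwise on \<open>P\<close>.
\<close>
lemma Hom_SurjPoset:
  assumes "Arrow P Q p \<in> Obj SurjPoset" "Arrow P' Q' p' \<in> Obj SurjPoset"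
  shows "Hom SurjPoset (Arrow P Q p) (Arrow P' Q' p') =
    {Arrow (Arrow P Q p) (Arrow P' Q' p') (Arrow P P' u, Arrow Q Q' v) | u v.
      u \<in> points P \<rightarrow>\<^sub>E points P' \<and> preserves (le P) (le P') u \<and>
      v \<in> points Q \<rightarrow>\<^sub>E points Q' \<and> preserves (le Q) (le Q') v \<and>
      (\<forall>a \<in> points P. p' (u a) = v (p a))}"
proof -
  have Arr: "Arrow P Q p \<in> Arr Poset" "Arrow P' Q' p' \<in> Arr Poset"
    and surj: "p ` points P = points Q" "p' ` points P' = points Q'"
    and posets: "is_poset P" "is_poset Q" "is_poset P'" "is_poset Q'"
    using assms by (auto simp: Obj_SurjPoset Poset_def concrete_category_def)
  have Comp: "Arrow B D g \<cdot>\<^bsub>Poset\<^esub> Arrow A B f = Arrow A D (compose (points A) g f)"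
    for A B D :: "'a poset" and f g
    by (simp add: Poset_def concrete_category_def)
  have eq: "(compose A f g = compose A h k) = (\<forall>a\<in>A. f (g a) = h (k a))"
    for A and f g h k :: "'a \<Rightarrow> 'a"
    by (auto simp: compose_def fun_eq_iff)
  have Dom_Cod: "Dom Poset = source" "Cod Poset = target"
    by (simp_all add: Poset_def concrete_category_def)
  show ?thesis
    using Arr surj posets
    by (auto simp: SurjPoset_def Hom_full_subcategory Hom_arrow_category Hom_Poset
        Dom_Cod Comp eq)
qed


section \<open>Pulling back the order of the target along a surjection\<close>

definition pullback_rel :: "'a set \<Rightarrow> ('a \<Rightarrow> 'b) \<Rightarrow> 'b rel \<Rightarrow> 'a rel" where
  "pullback_rel A p r = {(a, b). a \<in> A \<and> b \<in> A \<and> (p a, p b) \<in> r}"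

definition pullback_spec :: "'a poset_map \<Rightarrow> 'a spec_poset" where
  "pullback_spec p = \<lparr>points = points (source p), le = le (source p),
    spec = pullback_rel (points (source p)) (underlying p) (le (target p))\<rparr>"

definition pullback_functor ::
    "('a poset_map, ('a poset_map, 'a poset_map \<times> 'a poset_map) arrow,
      'a spec_poset, ('a spec_poset, 'a \<Rightarrow> 'a) arrow) cat_map" where
  "pullback_functor =
    \<lparr>on_Obj = pullback_spec,
     on_Arr = (\<lambda>f. Arrow (pullback_spec (source f)) (pullback_spec (target f))
                     (underlying (fst (underlying f))))\<rparr>"

lemma is_spec_poset_pullback_spec:
  assumes "p \<in> Obj SurjPoset"
  shows "is_spec_poset (pullback_spec p)"
  using assms
  by (auto simp: Obj_SurjPoset is_spec_poset_def pullback_spec_def pullback_rel_def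
      is_poset_def partial_order_on_def preorder_on_def preserves_def refl_on_def
      intro!: transI dest: transD)
    (auto dest: transD)

lemma pullback_functor_Hom:
  assumes f: "f \<in> Hom SurjPoset p q" and p: "p \<in> Obj SurjPoset" and q: "q \<in> Obj SurjPoset"
  shows "on_Arr pullback_functor f \<in> Hom SpecPoset (pullback_spec p) (pullback_spec q)"
proof -
  obtain P Q h where p': "p = Arrow P Q h" using arrow.exhaust by blast
  obtain P' Q' h' where q': "q = Arrow P' Q' h'" using arrow.exhaust by blast
  show ?thesis
    using f is_spec_poset_pullback_spec[OF p] is_spec_poset_pullback_spec[OF q]
      Hom_SurjPoset[OF p[unfolded p'] q[unfolded q']]
    by (auto simp: p' q' Hom_SpecPoset pullback_functor_def pullback_spec_def
        pullback_rel_def preserves_def)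
qed

lemma is_functor_pullback_functor: "is_functor SurjPoset SpecPoset pullback_functor"
proof -
  interpret category SurjPoset by (rule category_SurjPoset)
  have Obj: "p \<in> Obj SurjPoset" "q \<in> Obj SurjPoset"
    if "f \<in> Hom SurjPoset p q" for f and p q :: "'a poset_map"
    using that Dom_in_Obj Cod_in_Obj by (auto simp: Hom_def)
  show ?thesis
  proof (rule is_functorI)
    show "category SurjPoset" "category SpecPoset"
      by (rule category_SurjPoset category_SpecPoset)+
    show "on_Obj pullback_functor p \<in> Obj SpecPoset" if "p \<in> Obj SurjPoset"
      for p :: "'a poset_map"
      using is_spec_poset_pullback_spec[OF that]
      by (simp add: pullback_functor_def SpecPoset_def concrete_category_def)
    show "on_Arr pullback_functor f
        \<in> Hom SpecPoset (on_Obj pullback_functor p) (on_Obj pullback_functor q)"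
      if "f \<in> Hom SurjPoset p q" for p q :: "'a poset_map" and f
      using pullback_functor_Hom[OF that Obj[OF that]] by (simp add: pullback_functor_def)
    show "on_Arr pullback_functor (Id SurjPoset p) = Id SpecPoset (on_Obj pullback_functor p)"
      if "p \<in> Obj SurjPoset" for p :: "'a poset_map"
      using that
      by (auto simp: Obj_SurjPoset)
        (auto simp: pullback_functor_def SpecPoset_def SurjPoset_def full_subcategory_def
          arrow_category_def Poset_def concrete_category_def pullback_spec_def)
    show "on_Arr pullback_functor (g \<cdot>\<^bsub>SurjPoset\<^esub> f)
        = on_Arr pullback_functor g \<cdot>\<^bsub>SpecPoset\<^esub> on_Arr pullback_functor f"
      if f: "f \<in> Hom SurjPoset p q" and g: "g \<in> Hom SurjPoset q r"
      for p q r :: "'a poset_map" and f g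
    proof -
      have "source f = p" "source (fst (underlying f)) = source p"
        using f by (auto simp: Hom_def SurjPoset_def full_subcategory_def
            arrow_category_def Poset_def concrete_category_def)
      then show ?thesis
        by (simp add: pullback_functor_def SpecPoset_def SurjPoset_def full_subcategory_def
            arrow_category_def Poset_def concrete_category_def pullback_spec_def)
    qed
  qed
qed

text \<open>
  In a commuting square whose left side \<open>p\<close> is surjective, the bottom \<open>v\<close> is forced by the
  top \<open>u\<close> through \<open>v (p a) = p' (u a)\<close>. This formula gives a well-defined monotone map
  exactly when \<open>p a \<le> p b\<close> implies \<open>p' (u a) \<le> p' (u b)\<close>, that is, when \<open>u\<close> preserves
  the pulled back preorders; antisymmetry of the target order makes it well defined.
\<close>
lemma pullback_functor_fully_faithful:
  assumes p: "p \<in> Obj SurjPoset" and q: "q \<in> Obj SurjPoset"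
  shows "bij_betw (on_Arr pullback_functor) (Hom SurjPoset p q)
    (Hom SpecPoset (pullback_spec p) (pullback_spec q))"
proof -
  obtain P Q h where p': "p = Arrow P Q h" using arrow.exhaust by blast
  obtain P' Q' h' where q': "q = Arrow P' Q' h'" using arrow.exhaust by blast
  note Hom = Hom_SurjPoset[OF p[unfolded p'] q[unfolded q'], folded p' q']
  have h: "h ` points P = points Q" and Q: "is_poset Q"
    using p by (auto simp: p' Obj_SurjPoset)
  have h': "h' \<in> points P' \<rightarrow> points Q'" and Q': "is_poset Q'"
    using q by (auto simp: q' Obj_SurjPoset)
  show ?thesis
    unfolding bij_betw_def
  proof (intro conjI equalityI)
    show "inj_on (on_Arr pullback_functor) (Hom SurjPoset p q)"
    proof (rule inj_onI)
      fix f g assume "f \<in> Hom SurjPoset p q" "g \<in> Hom SurjPoset p q"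
        and eq: "on_Arr pullback_functor f = on_Arr pullback_functor g"
      then obtain u v u' v' where
        f: "f = Arrow p q (Arrow P P' u, Arrow Q Q' v)" and
        g: "g = Arrow p q (Arrow P P' u', Arrow Q Q' v')" and
        v: "v \<in> extensional (points Q)" "v' \<in> extensional (points Q)" and
        uv: "\<forall>a\<in>points P. h' (u a) = v (h a)" "\<forall>a\<in>points P. h' (u' a) = v' (h a)"
        unfolding Hom by (auto simp: PiE_iff)
      have u: "u = u'" using eq by (simp add: f g pullback_functor_def)
      have "v = v'"
      proof (rule extensionalityI[OF v])
        fix b assume "b \<in> points Q"
        then obtain a where "a \<in> points P" "b = h a" using h by blast
        then show "v b = v' b" using uv u by metis
      qed
      with u show "f = g" by (simp add: f g)
    qed
    show "on_Arr pullback_functor ` Hom SurjPoset p q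
        \<subseteq> Hom SpecPoset (pullback_spec p) (pullback_spec q)"
      using pullback_functor_Hom[OF _ p q] by blast
    show "Hom SpecPoset (pullback_spec p) (pullback_spec q)
        \<subseteq> on_Arr pullback_functor ` Hom SurjPoset p q"
    proof
      fix f assume "f \<in> Hom SpecPoset (pullback_spec p) (pullback_spec q)"
      then obtain u where f: "f = Arrow (pullback_spec p) (pullback_spec q) u"
        and u: "u \<in> points P \<rightarrow>\<^sub>E points P'" "preserves (le P) (le P') u"
        and pres: "preserves (pullback_rel (points P) h (le Q))
          (pullback_rel (points P') h' (le Q')) u"
        by (auto simp: Hom_SpecPoset pullback_spec_def p' q')
      have mono: "(h' (u a), h' (u b)) \<in> le Q'"
        if "a \<in> points P" "b \<in> points P" "(h a, h b) \<in> le Q" for a b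
        using pres that by (auto simp: preserves_def pullback_rel_def)
      \<comment> \<open>By \<open>mono\<close> and antisymmetry, the choice of the preimage does not affect the value.\<close>
      define v where "v = (\<lambda>b\<in>points Q. h' (u (inv_into (points P) h b)))"
      have pre: "inv_into (points P) h b \<in> points P" "h (inv_into (points P) h b) = b"
        if "b \<in> points Q" for b
        using that h by (auto intro: inv_into_into f_inv_into_f)
      have "v (h a) = h' (u a)" if a: "a \<in> points P" for a
      proof -
        have ha: "h a \<in> points Q" using a h by blast
        have "(h a, h a) \<in> le Q"
          using Q ha by (auto simp: is_poset_def partial_order_on_def preorder_on_def refl_on_def)
        then have "(h' (u a), v (h a)) \<in> le Q'" "(v (h a), h' (u a)) \<in> le Q'"
          using mono[OF a pre(1)[OF ha]] mono[OF pre(1)[OF ha] a] pre[OF ha] ha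
          by (auto simp: v_def)
        then show ?thesis
          using Q' by (auto simp: is_poset_def partial_order_on_def dest: antisymD)
      qed
      moreover have "v \<in> points Q \<rightarrow>\<^sub>E points Q'"
        using u(1) h' pre(1) unfolding v_def by (auto simp: Pi_iff PiE_iff)
      moreover have "preserves (le Q) (le Q') v"
        using mono pre is_poset_le_subset[OF Q] by (fastforce simp: v_def preserves_def)
      ultimately have "Arrow p q (Arrow P P' u, Arrow Q Q' v) \<in> Hom SurjPoset p q"
        using u by (auto simp: Hom)
      moreover have "f = on_Arr pullback_functor (Arrow p q (Arrow P P' u, Arrow Q Q' v))"
        by (simp add: f pullback_functor_def)
      ultimately show "f \<in> on_Arr pullback_functor ` Hom SurjPoset p q"
        by blast
    qed
  qed
qed

text \<open>
  The preimage is the projection onto the poset reflection of the preorder. Its points are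
  representatives of the equivalence classes instead of the classes themselves, because the
  quotient has to live in the same type \<open>'a\<close>.
\<close>
lemma pullback_spec_surj:
  assumes "is_spec_poset X"
  shows "\<exists>p \<in> Obj SurjPoset. pullback_spec p = X"
proof -
  let ?A = "points X"
  have poset: "is_poset X" and sub: "le X \<subseteq> spec X" and
    AA: "spec X \<subseteq> ?A \<times> ?A" and refl: "refl_on ?A (spec X)" and trans: "trans (spec X)"
    using assms by (auto simp: is_spec_poset_def preorder_on_def)
  define r where
    "r = (\<lambda>a\<in>?A. SOME b. (a, b) \<in> spec X \<and> (b, a) \<in> spec X)"
  have r: "(a, r a) \<in> spec X" "(r a, a) \<in> spec X" if "a \<in> ?A" for a
  proof -
    have "\<exists>b. (a, b) \<in> spec X \<and> (b, a) \<in> spec X"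
      using refl that by (auto simp: refl_on_def)
    from someI_ex[OF this] show "(a, r a) \<in> spec X" "(r a, a) \<in> spec X"
      using that by (auto simp: r_def)
  qed
  have rA: "r a \<in> ?A" if "a \<in> ?A" for a
    using r[OF that] AA by blast
  have r_eq: "r a = r b" if ab: "(a, b) \<in> spec X" "(b, a) \<in> spec X" for a b
  proof -
    have "((a, c) \<in> spec X \<and> (c, a) \<in> spec X) = ((b, c) \<in> spec X \<and> (c, b) \<in> spec X)" for c
      using ab trans by (meson transD)
    moreover have "a \<in> ?A" "b \<in> ?A" using ab AA by auto
    ultimately show ?thesis by (simp add: r_def)
  qed
  have r_iff: "(r a, r b) \<in> spec X \<longleftrightarrow> (a, b) \<in> spec X" if "a \<in> ?A" "b \<in> ?A" for a b
    using r[OF that(1)] r[OF that(2)] trans by (meson transD)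
  define P :: "'a poset" where "P = \<lparr>points = ?A, le = le X\<rparr>"
  define Q :: "'a poset" where
    "Q = \<lparr>points = r ` ?A, le = spec X \<inter> (r ` ?A) \<times> (r ` ?A)\<rparr>"
  have "is_poset P"
    using poset by (simp add: is_poset_def P_def)
  moreover have "is_poset Q"
    unfolding is_poset_def partial_order_on_def preorder_on_def
  proof (intro conjI)
    show "le Q \<subseteq> points Q \<times> points Q" by (auto simp: Q_def)
    show "refl_on (points Q) (le Q)"
      using refl rA by (auto simp: Q_def refl_on_def)
    show "trans (le Q)"
      using trans by (auto simp: Q_def intro!: transI dest: transD)
    show "antisym (le Q)"
      by (rule antisymI) (auto simp: Q_def r_iff intro: r_eq)
  qed
  moreover have "preserves (le P) (le Q) r"
    using sub AA by (auto simp: preserves_def P_def Q_def r_iff dest!: subsetD)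
  moreover have "r \<in> points P \<rightarrow>\<^sub>E points Q" "r ` points P = points Q"
    by (auto simp: P_def Q_def r_def)
  ultimately have "Arrow P Q r \<in> Obj SurjPoset"
    by (auto simp: Obj_SurjPoset)
  moreover have "pullback_spec (Arrow P Q r) = X"
  proof -
    have "pullback_rel ?A r (le Q) = spec X"
      using AA r_iff by (auto simp: pullback_rel_def Q_def)
    then show ?thesis by (simp add: pullback_spec_def P_def)
  qed
  ultimately show ?thesis by blast
qed

theorem proposition3p2:
  shows "equivalent_categories
    (SpecPoset :: ('a spec_poset, ('a spec_poset, 'a \<Rightarrow> 'a) arrow) category)
    (SurjPoset :: ('a poset_map, ('a poset_map, 'a poset_map \<times> 'a poset_map) arrow) category)"
proof (rule equivalent_categories_if_fully_faithful_and_surjective)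
  show "is_functor (SurjPoset :: ('a poset_map, _) category) SpecPoset pullback_functor"
    by (rule is_functor_pullback_functor)
  show "\<exists>p \<in> Obj SurjPoset. on_Obj pullback_functor p = X" if "X \<in> Obj SpecPoset"
    for X :: "'a spec_poset"
    using that pullback_spec_surj
    by (simp add: pullback_functor_def SpecPoset_def concrete_category_def)
  show "bij_betw (on_Arr pullback_functor) (Hom SurjPoset p q)
      (Hom SpecPoset (on_Obj pullback_functor p) (on_Obj pullback_functor q))"
    if "p \<in> Obj SurjPoset" "q \<in> Obj SurjPoset" for p q :: "'a poset_map"
    using pullback_functor_fully_faithful[OF that] by (simp add: pullback_functor_def)
qed

end
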